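(* For every $\mathcal L_{\mathrm{wit}}$-term $t(x)$ that is either closed or has $x$ as its only free variable, there exist a polynomial $Q_t(T)\in\mathbb D[T]$ and a natural number $q_t$ such that, for every $q\ge q_t$, $$t^{\mathfrak N_{\mathrm{wit}}^*}(c_q)=Q_t(U_q).$$
   Context: $\mathbb N$ contains $0$. $\mathbb D=\mathbb Z[1/2]$ is the ring of dyadic rationals. For $q\in\mathbb N$ put $U_q=2^q$, and for $q\ge2$ put $c_q=\frac54U_q=5\cdot2^{q-2}$; expressions involving $c_q$ are considered only for $q\ge 2$. The language is $\mathcal L_{\mathrm{wit}}=\{0,1,+,\cdot,\le\}\cup\{\operatorname{sub},\operatorname{po},\operatorname{quo},\operatorname{half},\operatorname{obst},\operatorname{cof}\}$, where $\operatorname{sub},\operatorname{quo}$ are binary function symbols and $\operatorname{po},\operatorname{half},\operatorname{obst},\operatorname{cof}$ are unary function symbols. $\mathfrak N_{\mathrm{wit}}^*$ is the $\mathcal L_{\mathrm{wit}}$-structure with universe $\mathbb N$, with $0,1,+,\cdot,\le$ interpreted as usual, and: - $\operatorname{sub}(x,y)=x-y$ if $y\le x$, and $0$ otherwise; - $\operatorname{po}(x)=\max\{2^n\mid n\in\mathbb N,\ 2^n\le x+1\}$; - $\operatorname{quo}(s,r)=r/s$ if $s=2^m$ and $r=2^n$ for some $m,n\in\mathbb N$ and $s\le r$, and $0$ otherwise; - $\operatorname{half}(y)=y/2$ if $2\mid y$, and $0$ otherwise; - $\operatorname{obst}(0)=3$ and $\operatorname{cof}(0)=0$; for $n\ge1$,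 $\operatorname{obst}(n)=n/2^{\nu_2(n)}$ and $\operatorname{cof}(n)=2^{\nu_2(n)}$, where $\nu_2$ is the usual $2$-adic valuation. $t^{\mathfrak N_{\mathrm{wit}}^*}(c)$ is the value of $t$ in $\mathfrak N_{\mathrm{wit}}^*$ when $x$ is assigned $c$. *)

theory Defs
  imports "HOL-Computational_Algebra.Computational_Algebra"
begin

(* The relation symbol \<le> of the language does not occur in terms, so only the function
   symbols are represented.  Terms have no binders: fv collects all variables occurring. *)
datatype (fv: 'v) wit_term =
    Var 'v
  | Zero
  | One
  | Plus "'v wit_term" "'v wit_term"
  | Times "'v wit_term" "'v wit_term"
  | Sub "'v wit_term" "'v wit_term"
  | Po "'v wit_term"
  | Quo "'v wit_term" "'v wit_term"
  | Half "'v wit_term"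
  | Obst "'v wit_term"
  | Cof "'v wit_term"

definition wit_sub :: "nat \<Rightarrow> nat \<Rightarrow> nat" where
  "wit_sub x y = (if y \<le> x then x - y else 0)"

definition wit_po :: "nat \<Rightarrow> nat" where
  "wit_po x = Max {2 ^ n | n. 2 ^ n \<le> x + 1}"

(* In the definitions below, div is only applied where the division is exact. *)

definition wit_quo :: "nat \<Rightarrow> nat \<Rightarrow> nat" where
  "wit_quo s r = (if (\<exists>m n. s = 2 ^ m \<and> r = 2 ^ n) \<and> s \<le> r then r div s else 0)"

definition wit_half :: "nat \<Rightarrow> nat" where
  "wit_half y = (if 2 dvd y then y div 2 else 0)"

definition wit_obst :: "nat \<Rightarrow> nat" where
  "wit_obst n = (if n = 0 then 3 else n div 2 ^ multiplicity 2 n)"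

definition wit_cof :: "nat \<Rightarrow> nat" where
  "wit_cof n = (if n = 0 then 0 else 2 ^ multiplicity 2 n)"

primrec wit_eval :: "('v \<Rightarrow> nat) \<Rightarrow> 'v wit_term \<Rightarrow> nat" where
  "wit_eval \<sigma> (Var v) = \<sigma> v"
| "wit_eval \<sigma> Zero = 0"
| "wit_eval \<sigma> One = 1"
| "wit_eval \<sigma> (Plus s t) = wit_eval \<sigma> s + wit_eval \<sigma> t"
| "wit_eval \<sigma> (Times s t) = wit_eval \<sigma> s * wit_eval \<sigma> t"
| "wit_eval \<sigma> (Sub s t) = wit_sub (wit_eval \<sigma> s) (wit_eval \<sigma> t)"
| "wit_eval \<sigma> (Po t) = wit_po (wit_eval \<sigma> t)"
| "wit_eval \<sigma> (Quo s t) = wit_quo (wit_eval \<sigma> s) (wit_eval \<sigma> t)"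
| "wit_eval \<sigma> (Half t) = wit_half (wit_eval \<sigma> t)"
| "wit_eval \<sigma> (Obst t) = wit_obst (wit_eval \<sigma> t)"
| "wit_eval \<sigma> (Cof t) = wit_cof (wit_eval \<sigma> t)"

definition dyadic :: "rat set" where
  "dyadic = {of_int a / 2 ^ n | a n. True}"

definition U :: "nat \<Rightarrow> nat" where
  "U q = 2 ^ q"

(* Meaningful for q \<ge> 2 only, since q - 2 is truncated subtraction. *)
definition c :: "nat \<Rightarrow> nat" where
  "c q = 5 * 2 ^ (q - 2)"

lemma c_eq_U: "q \<ge> 2 \<Longrightarrow> (of_nat (c q) :: rat) = 5 / 4 * of_nat (U q)"
  by (auto simp: c_def U_def le_iff_add power_add)

end

theory Submission
  imports Defs
begin

text \<open>By induction on the term, its value at \<open>c q\<close> is, for large \<open>q\<close>, a dyadic polynomial in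
  \<open>u = 2 ^ q\<close>.  A polynomial in \<open>u\<close> has eventually constant sign, which handles \<open>sub\<close>.  If it is
  eventually positive, it eventually lies in \<open>[m, 2 * m)\<close> for a single monomial
  \<open>m = 2 powi k * u ^ d\<close>; so \<open>po\<close> is a monomial, and the value is a power of two only if it equals
  \<open>m\<close>, which for large \<open>q\<close> happens always or never; this handles \<open>quo\<close>.  A nonzero dyadic
  polynomial can be written as \<open>2 powi k * u ^ d * G\<close> with \<open>G\<close> having an odd integer as
  constant term, so \<open>G\<close> eventually takes odd integer values, and the two factors are \<open>cof\<close> and
  \<open>obst\<close>.  Finally \<open>half\<close> is governed by whether \<open>cof\<close> is eventually \<open>1\<close>.\<close>

section \<open>Dyadic rationals and dyadic polynomials\<close>

lemma dyadicI: "of_int a / 2 ^ n \<in> dyadic"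
  by (auto simp: dyadic_def)

lemma dyadicE:
  assumes "r \<in> dyadic"
  obtains a n where "r = of_int a / 2 ^ n"
  using assms by (auto simp: dyadic_def)

lemma dyadic_of_int [simp]: "of_int a \<in> dyadic"
  using dyadicI[of a 0] by simp

lemma dyadic_0 [simp]: "0 \<in> dyadic"
  using dyadic_of_int[of 0] by simp

lemma dyadic_add: "r \<in> dyadic \<Longrightarrow> s \<in> dyadic \<Longrightarrow> r + s \<in> dyadic"
proof (elim dyadicE)
  fix a b :: int and m n :: nat
  assume "r = of_int a / 2 ^ m" "s = of_int b / 2 ^ n"
  then have "r + s = of_int (a * 2 ^ n + b * 2 ^ m) / 2 ^ (m + n)"
    by (simp add: add_frac_eq power_add)
  then show "r + s \<in> dyadic" by (simp only: dyadicI)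
qed

lemma dyadic_mult: "r \<in> dyadic \<Longrightarrow> s \<in> dyadic \<Longrightarrow> r * s \<in> dyadic"
proof (elim dyadicE)
  fix a b :: int and m n :: nat
  assume "r = of_int a / 2 ^ m" "s = of_int b / 2 ^ n"
  then have "r * s = of_int (a * b) / 2 ^ (m + n)"
    by (simp add: power_add)
  then show "r * s \<in> dyadic" by (simp only: dyadicI)
qed

lemma dyadic_sum: "(\<And>i. i \<in> A \<Longrightarrow> g i \<in> dyadic) \<Longrightarrow> sum g A \<in> dyadic"
  by (induction A rule: infinite_finite_induct) (auto intro: dyadic_add)

lemma dyadic_powi [simp]: "2 powi k \<in> dyadic"
proof (cases "k \<ge> 0")
  case True
  then show ?thesis
    using dyadic_of_int[of "2 ^ nat k"] by (simp add: power_int_def)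
next
  case False
  then show ?thesis
    using dyadicI[of 1 "nat (- k)"] by (simp add: power_int_def field_simps)
qed

definition dyadic_poly :: "rat poly \<Rightarrow> bool" where
  "dyadic_poly P \<longleftrightarrow> (\<forall>i. coeff P i \<in> dyadic)"

lemma dyadic_poly_0 [simp]: "dyadic_poly 0"
  by (simp add: dyadic_poly_def)

lemma dyadic_poly_pCons [simp]: "dyadic_poly (pCons a P) \<longleftrightarrow> a \<in> dyadic \<and> dyadic_poly P"
  unfolding dyadic_poly_def by (auto simp: coeff_pCons split: nat.splits)

lemma dyadic_poly_add: "dyadic_poly P \<Longrightarrow> dyadic_poly R \<Longrightarrow> dyadic_poly (P + R)"
  by (simp add: dyadic_poly_def dyadic_add)

lemma dyadic_poly_mult: "dyadic_poly P \<Longrightarrow> dyadic_poly R \<Longrightarrow> dyadic_poly (P * R)"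
  by (simp add: dyadic_poly_def coeff_mult dyadic_sum dyadic_mult)

lemma dyadic_poly_smult: "r \<in> dyadic \<Longrightarrow> dyadic_poly P \<Longrightarrow> dyadic_poly (smult r P)"
  by (simp add: dyadic_poly_def dyadic_mult)

lemma dyadic_poly_diff: "dyadic_poly P \<Longrightarrow> dyadic_poly R \<Longrightarrow> dyadic_poly (P - R)"
  using dyadic_poly_add[of P "smult (-1) R"] dyadic_poly_smult[of "-1" R] dyadic_of_int[of "-1"]
  by simp

lemma dyadic_poly_monom: "r \<in> dyadic \<Longrightarrow> dyadic_poly (monom r d)"
  by (simp add: dyadic_poly_def)

text \<open>Horner's scheme multiplies denominators, so the exponents add up; the resulting
  \<open>n\<close> depends on \<open>P\<close> alone and serves all integers \<open>x\<close> at
  once.\<close>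

lemma dyadic_poly_common_denominator:
  assumes "dyadic_poly P"
  shows "\<exists>n. \<forall>x \<in> \<int>. 2 ^ n * poly P x \<in> \<int>"
  using assms
proof (induction P)
  case 0
  then show ?case by simp
next
  case (pCons r P)
  then obtain n where n: "\<forall>x \<in> \<int>. 2 ^ n * poly P x \<in> \<int>" by auto
  obtain b m where r: "r = of_int b / 2 ^ m" using pCons.prems by (auto elim: dyadicE)
  have "2 ^ (m + n) * poly (pCons r P) x \<in> \<int>" if "x \<in> \<int>" for x
  proof -
    have "2 ^ (m + n) * poly (pCons r P) x = 2 ^ n * of_int b + 2 ^ m * x * (2 ^ n * poly P x)"
      by (simp add: r power_add field_simps)
    also have "\<dots> \<in> \<int>" using n that by (auto intro!: Ints_add Ints_mult)
    finally show ?thesis .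
  qed
  then show ?case by blast
qed

text \<open>Far enough out, the power \<open>2 ^ q\<close> absorbs the denominators of all coefficients except the
  constant one.\<close>

lemma dyadic_poly_odd_values:
  assumes "dyadic_poly G" "coeff G 0 = of_int a" "odd a"
  shows "\<forall>\<^sub>F q in sequentially. \<exists>b. odd b \<and> poly G (2 ^ q) = of_int b"
proof -
  obtain H where G: "G = pCons (of_int a) H" and H: "dyadic_poly H"
    using assms by (metis dyadic_poly_pCons pCons_cases coeff_pCons_0)
  obtain n where n: "\<forall>x \<in> \<int>. 2 ^ n * poly H x \<in> \<int>"
    using dyadic_poly_common_denominator[OF H] by blast
  have "\<exists>b. odd b \<and> poly G (2 ^ q) = of_int b" if "q \<ge> Suc n" for q
  proof -
    \<comment> \<open>One factor 2 beyond the denominator \<open>2 ^ n\<close> stays available, so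
      the nonconstant part of \<open>G\<close> takes an even value and the parity is that of
      \<open>a\<close>.\<close>
    define j where "j = q - Suc n"
    have j: "q = Suc n + j" using that by (simp add: j_def)
    obtain z where z: "2 ^ n * poly H (2 ^ q) = of_int z"
      using n by (metis Ints_cases Ints_numeral Ints_power)
    have "poly G (2 ^ q) = of_int a + 2 * 2 ^ j * (2 ^ n * poly H (2 ^ q))"
      by (simp add: G j power_add)
    also have "\<dots> = of_int (a + 2 * (2 ^ j * z))"
      unfolding z by simp
    finally show ?thesis using \<open>odd a\<close> by (intro exI[of _ "a + 2 * (2 ^ j * z)"]) simp
  qed
  then show ?thesis by (auto simp: eventually_sequentially)
qed

text \<open>Vanishing low coefficients are collected in \<open>d\<close>, and the first nonzero one
  determines \<open>k\<close>. Only the constant term of \<open>G\<close> becomes an odd integer;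
  its other coefficients may keep denominators.\<close>

lemma dyadic_poly_factor:
  assumes "dyadic_poly Q" "Q \<noteq> 0"
  obtains k d G a where "dyadic_poly G" "Q = monom (2 powi k) d * G"
    "coeff G 0 = of_int a" "odd a"
proof -
  have "\<exists>k d G a. dyadic_poly G \<and> Q = monom (2 powi k) d * G \<and> coeff G 0 = of_int a \<and> odd a"
    using assms
  proof (induction Q)
    case 0
    then show ?case by simp
  next
    case (pCons r P)
    show ?case
    proof (cases "r = 0")
      case True
      then obtain k d G a where G: "dyadic_poly G" "P = monom (2 powi k) d * G"
        "coeff G 0 = of_int a" "odd a"
        using pCons by (auto simp del: mult_eq_0_iff)
      have "pCons r P = monom (2 powi k) (Suc d) * G"
        using True G(2) by (simp add: monom_Suc)
      then show ?thesis using G by blast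
    next
      case False
      obtain b n where r: "r = of_int b / 2 ^ n" using pCons.prems by (auto elim: dyadicE)
      have "b \<noteq> 0" using False r by auto
      then obtain a where a: "b = 2 ^ multiplicity 2 b * a" "odd a"
        using multiplicity_decompose'[of b 2] by auto
      \<comment> \<open>This is the 2-adic valuation of \<open>r\<close>, possibly negative; the
        fraction need not be reduced.\<close>
      define k where "k = int (multiplicity 2 b) - int n"
      have rk: "r = 2 powi k * of_int a"
        by (subst r, subst a(1)) (simp add: k_def power_int_diff)
      have inv: "2 powi (-k) * (2 powi k * y) = y" for y :: rat
        by (simp add: power_int_minus)
      have "dyadic_poly (smult (2 powi (-k)) (pCons r P))"
        using pCons.prems by (intro dyadic_poly_smult) auto
      moreover have "pCons r P = monom (2 powi k) 0 * smult (2 powi (-k)) (pCons r P)"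
        by (simp add: monom_0 power_int_minus)
      moreover have "coeff (smult (2 powi (-k)) (pCons r P)) 0 = of_int a"
        by (simp add: rk inv)
      ultimately show ?thesis using a(2) by blast
    qed
  qed
  then show ?thesis using that by blast
qed

section \<open>Eventual behaviour of polynomials along the powers of two\<close>

lemma filterlim_two_power: "filterlim (\<lambda>q. 2 ^ q :: rat) at_top sequentially"
  unfolding filterlim_at_top
proof
  fix Z :: rat
  obtain n where n: "Z \<le> of_nat n" using real_arch_simple by blast
  have "Z \<le> 2 ^ q" if "q \<ge> n" for q
  proof -
    have "of_nat n \<le> (of_nat (2 ^ q) :: rat)"
      using that less_exp[of q] by (subst of_nat_le_iff) linarith
    also have "\<dots> = 2 ^ q" by simp
    finally show ?thesis using n by (rule order_trans[rotated])
  qed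
  then show "\<forall>\<^sub>F q in sequentially. Z \<le> 2 ^ q" by (auto simp: eventually_sequentially)
qed

text \<open>Induction along Horner's scheme with leading coefficient \<open>l\<close>: if
  \<open>poly p x\<close> is at least \<open>l\<close> and \<open>x\<close> is nonnegative, then
  \<open>a + x * poly p x\<close> is at least \<open>a + x * l\<close>, hence at least
  \<open>l\<close> once \<open>x\<close> reaches \<open>1 - a / l\<close>.\<close>

lemma poly_eventually_ge_lead_coeff:
  fixes p :: "'a :: linordered_field poly"
  assumes "lead_coeff p > 0"
  shows "\<forall>\<^sub>F x in at_top. poly p x \<ge> lead_coeff p"
  using assms
proof (induction p)
  case 0
  then show ?case by simp
next
  case (pCons a p)
  show ?case
  proof (cases "p = 0")
    case True
    then show ?thesis by simp
  next
    case False
    let ?l = "lead_coeff p"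
    have l: "?l > 0" using pCons.prems False by simp
    have "\<forall>\<^sub>F x in at_top. max 0 (1 - a / ?l) \<le> x" by (rule eventually_ge_at_top)
    with pCons.IH[OF l] have "\<forall>\<^sub>F x in at_top. poly (pCons a p) x \<ge> ?l"
    proof eventually_elim
      case (elim x)
      then have "?l * (1 - a / ?l) \<le> ?l * x" "x * ?l \<le> x * poly p x"
        using l by (auto intro: mult_left_mono)
      moreover have "?l * (1 - a / ?l) = ?l - a" using False by (simp add: right_diff_distrib)
      moreover have "x * ?l = ?l * x" by (rule mult.commute)
      ultimately show ?case unfolding poly_pCons by linarith
    qed
    then show ?thesis using False by (simp del: poly_pCons)
  qed
qed

text \<open>Stated with a degree bound \<open>d\<close> to suit differences with a monomial, whose
  coefficient at \<open>d\<close> is easily computed.\<close>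

lemma poly_two_power_eventually_pos:
  fixes p :: "rat poly"
  assumes "degree p \<le> d" "coeff p d > 0"
  shows "\<forall>\<^sub>F q in sequentially. poly p (2 ^ q) > 0"
proof -
  have "degree p = d" using assms le_degree[of p d] by simp
  then have l: "lead_coeff p > 0" using assms by simp
  have "\<forall>\<^sub>F x in at_top. poly p x > 0"
    using poly_eventually_ge_lead_coeff[OF l] by eventually_elim (use l in linarith)
  then show ?thesis using filterlim_two_power by (rule eventually_compose_filterlim)
qed

lemma poly_two_power_eventually_sign:
  fixes p :: "rat poly"
  obtains "\<forall>\<^sub>F q in sequentially. poly p (2 ^ q) > 0"
  | "\<forall>\<^sub>F q in sequentially. poly p (2 ^ q) < 0"
  | "p = 0"
proof (cases "lead_coeff p" "0 :: rat" rule: linorder_cases)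
  case less
  then have "\<forall>\<^sub>F q in sequentially. poly (- p) (2 ^ q) > 0"
    by (intro poly_two_power_eventually_pos[of _ "degree p"]) auto
  then show ?thesis using that(2) by simp
next
  case equal
  then show ?thesis using that(3) by simp
next
  case greater
  then show ?thesis using that(1) poly_two_power_eventually_pos[of p "degree p"] by simp
qed

text \<open>The bounds below compare \<open>P\<close> with the three neighbouring candidates for its dominating power
  of two; only the comparison with the middle one may depend on lower-order terms.\<close>

lemma dyadic_poly_bracket:
  assumes P: "dyadic_poly P" and pos: "\<forall>\<^sub>F q in sequentially. poly P (2 ^ q) > 0"
  obtains k d where "\<forall>\<^sub>F q in sequentially.
    2 powi k * (2 ^ q) ^ d \<le> poly P (2 ^ q) \<and> poly P (2 ^ q) < 2 * (2 powi k * (2 ^ q) ^ d)"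
proof -
  define d where "d = degree P"
  \<comment> \<open>This rules out a negative leading coefficient.\<close>
  have "\<not> (\<forall>\<^sub>F q in sequentially. poly P (2 ^ q) < 0)"
  proof
    assume "\<forall>\<^sub>F q in sequentially. poly P (2 ^ q) < 0"
    with pos have "\<forall>\<^sub>F q :: nat in sequentially. False" by eventually_elim simp
    then show False by simp
  qed
  moreover have "P \<noteq> 0" using pos by auto
  ultimately have lc: "coeff P d > 0"
    using poly_two_power_eventually_pos[of "- P" d]
    by (cases "coeff P d" "0 :: rat" rule: linorder_cases) (auto simp: d_def)
  obtain b n where bn: "coeff P d = of_int b / 2 ^ n"
    using dyadicE[of "coeff P d"] P unfolding dyadic_poly_def by metis
  have "b > 0" using lc bn by (simp add: zero_less_divide_iff)
  then obtain m where m: "2 ^ m \<le> nat b" "nat b < 2 ^ (m + 1)"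
    using ex_power_ivl1[of 2 "nat b"] by (metis One_nat_def Suc_leI order_refl zero_less_nat_eq)
  have m': "(2 ^ m :: rat) \<le> of_int b" "of_int b < (2 * 2 ^ m :: rat)"
    using m \<open>b > 0\<close>
    by (metis of_nat_le_iff of_nat_power of_nat_numeral of_nat_nat of_int_of_nat_eq less_imp_le,
        metis of_nat_less_iff of_nat_power of_nat_numeral of_nat_nat of_int_of_nat_eq less_imp_le
          power_Suc Suc_eq_plus1)
  \<comment> \<open>The numerator \<open>b\<close> lies in \<open>[2 ^ m, 2 * 2 ^ m)\<close>, so the
    leading coefficient lies between \<open>2 powi k\<close> and its double.\<close>
  define k where "k = int m - int n"
  have k: "2 powi k \<le> coeff P d" "coeff P d < 2 * 2 powi k"
    using m' by (simp_all add: bn k_def power_int_diff field_simps)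
  have half: "2 powi k = (2 * 2 powi (k - 1) :: rat)" for k :: int
    by (simp add: power_int_diff)
  have upper: "\<forall>\<^sub>F q in sequentially. poly P (2 ^ q) < 2 * (2 powi k * (2 ^ q) ^ d)"
    using poly_two_power_eventually_pos[of "monom (2 * 2 powi k) d - P" d] k
    by (simp add: d_def degree_diff_le degree_monom_le poly_monom mult.assoc)
  have lower: "\<forall>\<^sub>F q in sequentially. 2 powi (k - 1) * (2 ^ q) ^ d < poly P (2 ^ q)"
    using poly_two_power_eventually_pos[of "P - monom (2 powi (k - 1)) d" d] k half[of k]
      zero_less_power_int[of "2 :: rat" "k - 1"]
    by (simp add: d_def degree_diff_le degree_monom_le poly_monom)
  show ?thesis
  proof (rule poly_two_power_eventually_sign[of "P - monom (2 powi k) d"])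
    assume "\<forall>\<^sub>F q in sequentially. poly (P - monom (2 powi k) d) (2 ^ q) > 0"
    with upper show ?thesis
      by (intro that[of k d]) (auto simp: poly_monom elim: eventually_elim2)
  next
    assume "P - monom (2 powi k) d = 0"
    with upper show ?thesis
      by (intro that[of k d]) (auto simp: poly_monom elim: eventually_mono)
  next
    \<comment> \<open>This happens when the leading coefficient is exactly \<open>2 powi k\<close>
      and the next nonzero one is negative, as for T - 1. The bracket then drops to
      \<open>k - 1\<close>, whose upper end is the monomial for \<open>k\<close>.\<close>
    assume "\<forall>\<^sub>F q in sequentially. poly (P - monom (2 powi k) d) (2 ^ q) < 0"
    with lower show ?thesis
      by (intro that[of "k - 1" d]) (auto simp: poly_monom half[of k] mult.assoc elim: eventually_elim2)
  qed
qed

text \<open>Monomial values become single powers of two whose integer exponent is affine in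
  \<open>q\<close>, so comparing them is integer arithmetic.\<close>

lemma powi_times_power_power:
  "2 powi k * (2 ^ q) ^ d = (2 powi (k + int d * int q) :: rat)"
proof -
  have "(2 ^ q) ^ d = (2 powi int (d * q) :: rat)"
    unfolding power_int_of_nat by (simp add: mult.commute flip: power_mult)
  then show ?thesis by (simp add: power_int_add)
qed

section \<open>Functions that are eventually dyadic polynomials in the powers of two\<close>

text \<open>The property carried through the induction on terms; the filter hides the threshold, so
  thresholds of subterms combine automatically.\<close>

definition ev_dyadic :: "(nat \<Rightarrow> nat) \<Rightarrow> bool" where
  "ev_dyadic f \<longleftrightarrow>
     (\<exists>Q. dyadic_poly Q \<and> (\<forall>\<^sub>F q in sequentially. of_nat (f q) = poly Q (2 ^ q)))"

lemma ev_dyadicI: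
  "dyadic_poly Q \<Longrightarrow> \<forall>\<^sub>F q in sequentially. of_nat (f q) = poly Q (2 ^ q) \<Longrightarrow> ev_dyadic f"
  by (auto simp: ev_dyadic_def)

lemma ev_dyadicE:
  assumes "ev_dyadic f"
  obtains Q where "dyadic_poly Q" "\<forall>\<^sub>F q in sequentially. of_nat (f q) = poly Q (2 ^ q)"
  using assms by (auto simp: ev_dyadic_def)

lemma ev_dyadic_cong:
  assumes "ev_dyadic f" "\<forall>\<^sub>F q in sequentially. g q = f q"
  shows "ev_dyadic g"
proof -
  obtain Q where Q: "dyadic_poly Q" "\<forall>\<^sub>F q in sequentially. of_nat (f q) = poly Q (2 ^ q)"
    using assms(1) by (rule ev_dyadicE)
  show ?thesis
    by (rule ev_dyadicI[OF Q(1)]) (use Q(2) assms(2) in eventually_elim, simp)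
qed

lemma ev_dyadic_const: "ev_dyadic (\<lambda>_. n)"
  by (rule ev_dyadicI[of "[:of_nat n:]"]) (use dyadic_of_int[of "int n"] in auto)

text \<open>A negative \<open>k\<close> is harmless: it only contributes a dyadic
  coefficient.\<close>

lemma ev_dyadic_monomial:
  assumes "\<forall>\<^sub>F q in sequentially. of_nat (f q) = (2 powi (k + int d * int q) :: rat)"
  shows "ev_dyadic f"
  using assms
  by (intro ev_dyadicI[of "monom (2 powi k) d"])
    (auto simp: dyadic_poly_monom poly_monom powi_times_power_power)

lemma ev_dyadic_c: "ev_dyadic c"
proof (rule ev_dyadicI)
  show "dyadic_poly [:0, of_int 5 * 2 powi (-2):]"
    using dyadic_mult[OF dyadic_of_int dyadic_powi, of 5 "-2"] by simp
  show "\<forall>\<^sub>F q in sequentially. (of_nat (c q) :: rat) = poly [:0, of_int 5 * 2 powi (-2):] (2 ^ q)"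
    using eventually_ge_at_top[of 2]
    by eventually_elim (simp add: c_eq_U U_def power_int_minus)
qed

section \<open>Sums, products, comparison and truncated subtraction\<close>

lemma ev_dyadic_add:
  assumes "ev_dyadic f" "ev_dyadic g"
  shows "ev_dyadic (\<lambda>q. f q + g q)"
  using assms
proof (elim ev_dyadicE)
  fix P R
  assume *: "dyadic_poly P" "dyadic_poly R" "\<forall>\<^sub>F q in sequentially. of_nat (f q) = poly P (2 ^ q)"
    "\<forall>\<^sub>F q in sequentially. of_nat (g q) = poly R (2 ^ q)"
  show ?thesis
    by (rule ev_dyadicI[OF dyadic_poly_add[OF *(1,2)]]) (use *(3,4) in eventually_elim, simp)
qed

lemma ev_dyadic_mult:
  assumes "ev_dyadic f" "ev_dyadic g"
  shows "ev_dyadic (\<lambda>q. f q * g q)"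
  using assms
proof (elim ev_dyadicE)
  fix P R
  assume *: "dyadic_poly P" "dyadic_poly R" "\<forall>\<^sub>F q in sequentially. of_nat (f q) = poly P (2 ^ q)"
    "\<forall>\<^sub>F q in sequentially. of_nat (g q) = poly R (2 ^ q)"
  show ?thesis
    by (rule ev_dyadicI[OF dyadic_poly_mult[OF *(1,2)]]) (use *(3,4) in eventually_elim, simp)
qed

text \<open>The difference of the two polynomials has an eventually constant sign or is zero. Thus
  conditions comparing two such functions are eventually decided once and for all.\<close>

lemma ev_dyadic_compare:
  assumes "ev_dyadic f" "ev_dyadic g"
  obtains "\<forall>\<^sub>F q in sequentially. f q < g q"
  | "\<forall>\<^sub>F q in sequentially. f q = g q"
  | "\<forall>\<^sub>F q in sequentially. f q > g q"
proof -
  obtain P R :: "rat poly" where P: "\<forall>\<^sub>F q in sequentially. of_nat (f q) = poly P (2 ^ q)"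
    and R: "\<forall>\<^sub>F q in sequentially. of_nat (g q) = poly R (2 ^ q)"
    using assms by (auto simp: ev_dyadic_def)
  show ?thesis
  proof (rule poly_two_power_eventually_sign[of "P - R"])
    assume "\<forall>\<^sub>F q in sequentially. poly (P - R) (2 ^ q) > 0"
    with P R have "\<forall>\<^sub>F q in sequentially. f q > g q"
      by eventually_elim (simp flip: of_nat_less_iff[where 'a = rat])
    then show ?thesis by (rule that)
  next
    assume "\<forall>\<^sub>F q in sequentially. poly (P - R) (2 ^ q) < 0"
    with P R have "\<forall>\<^sub>F q in sequentially. f q < g q"
      by eventually_elim (simp flip: of_nat_less_iff[where 'a = rat])
    then show ?thesis by (rule that)
  next
    assume "P - R = 0"
    from P R have "\<forall>\<^sub>F q in sequentially. f q = g q"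
      by eventually_elim (use \<open>P - R = 0\<close> in \<open>simp flip: of_nat_eq_iff[where 'a = rat]\<close>)
    then show ?thesis by (rule that)
  qed
qed

lemma ev_dyadic_sub:
  assumes "ev_dyadic f" "ev_dyadic g"
  shows "ev_dyadic (\<lambda>q. wit_sub (f q) (g q))"
proof -
  obtain P R where P: "dyadic_poly P" "\<forall>\<^sub>F q in sequentially. of_nat (f q) = poly P (2 ^ q)"
    and R: "dyadic_poly R" "\<forall>\<^sub>F q in sequentially. of_nat (g q) = poly R (2 ^ q)"
    using assms by (auto simp: ev_dyadic_def)
  have zero: ?thesis if "\<forall>\<^sub>F q in sequentially. f q \<le> g q"
    by (rule ev_dyadic_cong[OF ev_dyadic_const[of 0]])
      (use that in eventually_elim, simp add: wit_sub_def)
  from assms show ?thesis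
  proof (rule ev_dyadic_compare)
    assume gt: "\<forall>\<^sub>F q in sequentially. f q > g q"
    show ?thesis
      by (rule ev_dyadicI[OF dyadic_poly_diff[OF P(1) R(1)]])
        (use P(2) R(2) gt in eventually_elim, simp add: wit_sub_def of_nat_diff)
  qed (auto intro!: zero elim: eventually_mono)
qed

section \<open>Dominating powers of two and quotients\<close>

lemma wit_po_eq:
  assumes "2 ^ n \<le> x + 1" "x + 1 < 2 ^ Suc n"
  shows "wit_po x = 2 ^ n"
  unfolding wit_po_def
proof (rule Max_eqI)
  have "{2 ^ m :: nat |m. 2 ^ m \<le> x + 1} \<subseteq> {..x + 1}" by auto
  then show "finite {2 ^ m :: nat |m. 2 ^ m \<le> x + 1}" by (rule finite_subset) simp
  show "2 ^ n \<in> {2 ^ m |m. 2 ^ m \<le> x + 1}" using assms by auto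
  fix y assume "y \<in> {2 ^ m :: nat |m. 2 ^ m \<le> x + 1}"
  then obtain m where m: "y = 2 ^ m" "2 ^ m \<le> x + 1" by auto
  then have "2 ^ m < (2 :: nat) ^ Suc n" using assms by linarith
  then have "m < Suc n" by (rule power_less_imp_less_exp[rotated]) simp
  then show "y \<le> 2 ^ n" using m by simp
qed

text \<open>Integrality of \<open>x\<close> forces a nonnegative exponent: \<open>x\<close> is
  positive, hence at least 1, and so \<open>2 powi (e + 1)\<close> exceeds 1.\<close>

lemma powi_bracket_nat:
  assumes "2 powi e \<le> (of_nat x :: rat)" "of_nat x < (2 * 2 powi e :: rat)"
  obtains n where "e = int n" "2 ^ n \<le> x" "x < 2 ^ Suc n"
proof -
  have "(0 :: rat) < of_nat x"
    using zero_less_power_int assms(1) by (rule less_le_trans) simp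
  then have "(1 :: rat) \<le> of_nat x" by simp
  then have "(2 powi 0 :: rat) < 2 powi (e + 1)" using assms(2) by (simp add: power_int_add)
  then have "0 \<le> e" using power_int_increasing[of "e + 1" 0 "2 :: rat"] by linarith
  then obtain n where n: "e = int n" using nonneg_int_cases by blast
  have "of_nat (2 ^ n) \<le> (of_nat x :: rat)" "of_nat x < (of_nat (2 ^ Suc n) :: rat)"
    using assms n by simp_all
  then show ?thesis using n that unfolding of_nat_le_iff of_nat_less_iff by blast
qed

lemma ev_dyadic_bracket:
  assumes "ev_dyadic f" "\<forall>\<^sub>F q in sequentially. f q > 0"
  obtains k d where "\<forall>\<^sub>F q in sequentially.
    \<exists>n. k + int d * int q = int n \<and> 2 ^ n \<le> f q \<and> f q < 2 ^ Suc n"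
proof -
  obtain P where P: "dyadic_poly P" "\<forall>\<^sub>F q in sequentially. of_nat (f q) = poly P (2 ^ q)"
    using assms(1) by (rule ev_dyadicE)
  from P(2) assms(2) have "\<forall>\<^sub>F q in sequentially. poly P (2 ^ q) > 0"
    by eventually_elim (metis of_nat_0_less_iff)
  then obtain k d where "\<forall>\<^sub>F q in sequentially.
    2 powi k * (2 ^ q) ^ d \<le> poly P (2 ^ q) \<and> poly P (2 ^ q) < 2 * (2 powi k * (2 ^ q) ^ d)"
    using dyadic_poly_bracket[OF P(1)] by blast
  with P(2) have "\<forall>\<^sub>F q in sequentially.
    \<exists>n. k + int d * int q = int n \<and> 2 ^ n \<le> f q \<and> f q < 2 ^ Suc n"
  proof eventually_elim
    case (elim q)
    then show ?case
      using powi_bracket_nat[of "k + int d * int q" "f q"]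
      unfolding powi_times_power_power by metis
  qed
  then show ?thesis by (rule that)
qed

lemma ev_dyadic_po:
  assumes "ev_dyadic f"
  shows "ev_dyadic (\<lambda>q. wit_po (f q))"
proof -
  \<comment> \<open>Bracketing \<open>f q + 1\<close> matches the shift in \<open>wit_po\<close> and
    supplies positivity even where \<open>f q\<close> is 0.\<close>
  obtain k d where "\<forall>\<^sub>F q in sequentially.
    \<exists>n. k + int d * int q = int n \<and> 2 ^ n \<le> f q + 1 \<and> f q + 1 < 2 ^ Suc n"
    using ev_dyadic_bracket[OF ev_dyadic_add[OF assms ev_dyadic_const[of 1]]] by auto
  then have "\<forall>\<^sub>F q in sequentially. of_nat (wit_po (f q)) = (2 powi (k + int d * int q) :: rat)"
    by eventually_elim (auto simp: wit_po_eq simp del: power_Suc)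
  then show ?thesis by (rule ev_dyadic_monomial)
qed

text \<open>A power of two in \<open>[2 ^ n, 2 ^ Suc n)\<close> must be \<open>2 ^ n\<close>. Being
  a power of two thus reduces to equality with the lower end of the bracket, which
  \<open>ev_dyadic_compare\<close> decides.\<close>

lemma ev_dyadic_power_of_two_cases:
  assumes "ev_dyadic f"
  obtains "\<forall>\<^sub>F q in sequentially. \<nexists>n. f q = 2 ^ n"
  | k d where "\<forall>\<^sub>F q in sequentially. \<exists>n. f q = 2 ^ n \<and> int n = k + int d * int q"
proof -
  note cases = that
  have none: thesis if "\<forall>\<^sub>F q in sequentially. f q = 0"
    by (rule cases(1)) (use that in eventually_elim, simp)
  have some: thesis if pos: "\<forall>\<^sub>F q in sequentially. f q > 0"
  proof -
    obtain k d where kd: "\<forall>\<^sub>F q in sequentially.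
      \<exists>n. k + int d * int q = int n \<and> 2 ^ n \<le> f q \<and> f q < 2 ^ Suc n"
      using ev_dyadic_bracket[OF assms pos] .
    \<comment> \<open>By \<open>kd\<close> the exponent is eventually a natural number, so
      \<open>nat\<close> does not truncate there.\<close>
    define h :: "nat \<Rightarrow> nat" where "h q = 2 ^ nat (k + int d * int q)" for q
    have h: "ev_dyadic h"
      by (rule ev_dyadic_monomial[of _ k d]) (use kd in eventually_elim, auto simp: h_def)
    have never: thesis if "\<forall>\<^sub>F q in sequentially. f q \<noteq> h q"
    proof (rule cases(1))
      from kd that that show "\<forall>\<^sub>F q in sequentially. \<nexists>n. f q = 2 ^ n"
      proof eventually_elim
        case (elim q)
        then obtain n where n: "h q = 2 ^ n" "2 ^ n \<le> f q" "f q < 2 ^ Suc n"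
          by (auto simp: h_def)
        have "f q = 2 ^ n" if "f q = 2 ^ m" for m
        proof -
          have "n \<le> m" "m < Suc n"
            using n that by (metis power_increasing_iff one_less_numeral_iff semiring_norm(76),
              metis power_strict_increasing_iff one_less_numeral_iff semiring_norm(76))
          then show ?thesis using that by simp
        qed
        then show ?case using elim n by auto
      qed
    qed
    from assms h show thesis
    proof (rule ev_dyadic_compare)
      assume "\<forall>\<^sub>F q in sequentially. f q = h q"
      with kd show thesis
        by (intro cases(2)[of k d]) (auto simp: h_def elim: eventually_elim2)
    qed (auto intro!: never elim: eventually_mono)
  qed
  from assms ev_dyadic_const[of 0] show ?thesis
    by (rule ev_dyadic_compare) (use none some in auto)
qed

lemma wit_quo_power:
  assumes "m \<le> n"
  shows "wit_quo (2 ^ m) (2 ^ n) = 2 ^ (n - m)"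
  using assms by (auto simp: wit_quo_def power_diff)

lemma ev_dyadic_quo:
  assumes "ev_dyadic f" "ev_dyadic g"
  shows "ev_dyadic (\<lambda>q. wit_quo (f q) (g q))"
proof -
  have zero: ?thesis if "\<forall>\<^sub>F q in sequentially. wit_quo (f q) (g q) = 0"
    by (rule ev_dyadic_cong[OF ev_dyadic_const[of 0] that])
  from assms(1) show ?thesis
  proof (rule ev_dyadic_power_of_two_cases)
    assume "\<forall>\<^sub>F q in sequentially. \<nexists>n. f q = 2 ^ n"
    then show ?thesis
      by (intro zero) (auto simp: wit_quo_def elim: eventually_mono)
  next
    fix k d assume f: "\<forall>\<^sub>F q in sequentially. \<exists>n. f q = 2 ^ n \<and> int n = k + int d * int q"
    from assms(2) show ?thesis
    proof (rule ev_dyadic_power_of_two_cases)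
      assume "\<forall>\<^sub>F q in sequentially. \<nexists>n. g q = 2 ^ n"
      then show ?thesis
        by (intro zero) (auto simp: wit_quo_def elim: eventually_mono)
    next
      fix k' d' assume g: "\<forall>\<^sub>F q in sequentially. \<exists>n. g q = 2 ^ n \<and> int n = k' + int d' * int q"
      \<comment> \<open>Beyond this threshold a difference in slopes outweighs the constants, so the
        exponents compare as the pairs \<open>(d, k)\<close> and \<open>(d', k')\<close> do
        lexicographically.\<close>
      have large: "\<forall>\<^sub>F q in sequentially. \<bar>k - k'\<bar> < int q"
        using eventually_ge_at_top[of "Suc (nat \<bar>k - k'\<bar>)"] by eventually_elim linarith
      show ?thesis
      proof (cases "d < d' \<or> d = d' \<and> k \<le> k'")
        case True
        from f g large have "\<forall>\<^sub>F q in sequentially. of_nat (wit_quo (f q) (g q)) =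
          (2 powi ((k' - k) + int (d' - d) * int q) :: rat)"
        proof eventually_elim
          case (elim q)
          then obtain m n where mn: "f q = 2 ^ m" "int m = k + int d * int q"
            "g q = 2 ^ n" "int n = k' + int d' * int q" by auto
          have eq: "(k' - k) + int (d' - d) * int q = int n - int m"
            using True mn by (auto simp: of_nat_diff algebra_simps)
          have "int (d' - d) * int q \<ge> int q" if "d < d'"
            using that mult_right_mono[of 1 "int (d' - d)" "int q"] by simp
          then have "m \<le> n"
            using True elim(3) eq by (cases "d < d'") auto
          then show ?case
            unfolding eq mn(1,3) wit_quo_power[OF \<open>m \<le> n\<close>] by (simp flip: of_nat_diff)
        qed
        then show ?thesis by (rule ev_dyadic_monomial)
      next
        case False
        from f g large have "\<forall>\<^sub>F q in sequentially. wit_quo (f q) (g q) = 0"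
        proof eventually_elim
          case (elim q)
          then obtain m n where mn: "f q = 2 ^ m" "int m = k + int d * int q"
            "g q = 2 ^ n" "int n = k' + int d' * int q" by auto
          have eq: "int (d - d') * int q = int m - int n + (k' - k)"
            using False mn by (auto simp: of_nat_diff algebra_simps)
          have "int (d - d') * int q \<ge> int q" if "d' < d"
            using that mult_right_mono[of 1 "int (d - d')" "int q"] by simp
          then have "n < m"
            using False elim(3) eq by (cases "d' < d") auto
          then have "g q < f q" using mn by simp
          then show ?case by (simp add: wit_quo_def)
        qed
        then show ?thesis by (rule zero)
      qed
    qed
  qed
qed

section \<open>Two-power parts, odd parts and halving\<close>

lemma wit_cof_obst_power_times_odd:
  assumes "odd b"
  shows "wit_cof (2 ^ n * b) = 2 ^ n" "wit_obst (2 ^ n * b) = b"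
proof -
  have "multiplicity 2 (2 ^ n * b) = n"
    using assms by (intro multiplicity_eqI) auto
  then show "wit_cof (2 ^ n * b) = 2 ^ n" "wit_obst (2 ^ n * b) = b"
    using assms by (auto simp: wit_cof_def wit_obst_def elim: oddE)
qed

text \<open>A negative exponent would make \<open>b\<close> a multiple of 2. Once the exponent is
  nonnegative, \<open>b\<close> inherits its sign from \<open>x\<close>.\<close>

lemma powi_times_odd_nat:
  assumes "of_nat x = (2 powi e * of_int b :: rat)" "odd b"
  obtains n m where "e = int n" "b = int m" "x = 2 ^ n * m"
proof (cases "e \<ge> 0")
  case True
  then obtain n where n: "e = int n" using nonneg_int_cases by blast
  have "of_int (int x) = (of_int (2 ^ n * b) :: rat)" using assms(1) n by simp
  then have x: "int x = 2 ^ n * b" unfolding of_int_eq_iff .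
  then have "b \<ge> 0" by (metis of_nat_0_le_iff zero_le_mult_iff zero_less_power zero_less_numeral not_le)
  then obtain m where m: "b = int m" using nonneg_int_cases by blast
  have "int x = int (2 ^ n * m)" using x m by simp
  then have "x = 2 ^ n * m" unfolding of_nat_eq_iff .
  then show ?thesis using that n m by blast
next
  case False
  \<comment> \<open>Writing the exponent with \<open>Suc\<close> exposes the factor 2 that
    contradicts oddness of \<open>b\<close>.\<close>
  then obtain n where n: "e = - int (Suc n)"
    by (metis add.inverse_inverse int_cases not_le of_nat_0_le_iff)
  have "of_int (2 ^ Suc n * int x) = (of_int b :: rat)"
    using assms(1) unfolding n power_int_minus power_int_of_nat by (simp add: field_simps)
  then have "2 ^ Suc n * int x = b" unfolding of_int_eq_iff .
  then show ?thesis using assms(2) by auto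
qed

text \<open>Both functions are read off one factorisation: the monomial gives the power of two, and
  \<open>G\<close> gives the odd part.\<close>

lemma ev_dyadic_cof_obst:
  assumes "ev_dyadic f"
  shows "ev_dyadic (\<lambda>q. wit_cof (f q)) \<and> ev_dyadic (\<lambda>q. wit_obst (f q))"
proof -
  obtain Q where Q: "dyadic_poly Q" "\<forall>\<^sub>F q in sequentially. of_nat (f q) = poly Q (2 ^ q)"
    using assms by (rule ev_dyadicE)
  show ?thesis
  proof (cases "Q = 0")
    \<comment> \<open>Here \<open>f q\<close> is eventually 0, and the conventions at 0 give the
      constants 0 and 3.\<close>
    case True
    from Q(2) have "\<forall>\<^sub>F q in sequentially. wit_cof (f q) = 0"
      by eventually_elim (simp add: True wit_cof_def)
    moreover from Q(2) have "\<forall>\<^sub>F q in sequentially. wit_obst (f q) = 3"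
      by eventually_elim (simp add: True wit_obst_def)
    ultimately show ?thesis by (blast intro: ev_dyadic_cong[OF ev_dyadic_const[of 0]]
          ev_dyadic_cong[OF ev_dyadic_const[of 3]])
  next
    case False
    obtain k d G a where G: "dyadic_poly G" "Q = monom (2 powi k) d * G"
      "coeff G 0 = of_int a" "odd a"
      using dyadic_poly_factor[OF Q(1) False] .
    from Q(2) dyadic_poly_odd_values[OF G(1,3,4)]
    have *: "\<forall>\<^sub>F q in sequentially. of_nat (wit_cof (f q)) = (2 powi (k + int d * int q) :: rat) \<and>
      of_nat (wit_obst (f q)) = poly G (2 ^ q)"
    proof eventually_elim
      case (elim q)
      then obtain b where b: "odd b" "poly G (2 ^ q) = of_int b" by blast
      have "of_nat (f q) = 2 powi (k + int d * int q) * (of_int b :: rat)"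
        by (simp add: elim(1) G(2) b(2) poly_monom powi_times_power_power)
      then obtain n m where nm: "k + int d * int q = int n" "b = int m" "f q = 2 ^ n * m"
        using b(1) by (rule powi_times_odd_nat)
      then have "odd m" using b(1) by simp
      then show ?case using nm b(2) by (simp add: wit_cof_obst_power_times_odd)
    qed
    have "ev_dyadic (\<lambda>q. wit_cof (f q))"
      by (rule ev_dyadic_monomial[of _ k d]) (use * in eventually_elim, simp)
    moreover have "ev_dyadic (\<lambda>q. wit_obst (f q))"
      by (rule ev_dyadicI[OF G(1)]) (use * in eventually_elim, simp)
    ultimately show ?thesis ..
  qed
qed

text \<open>Turns parity into a comparison with a constant; 0 fits because its
  \<open>wit_cof\<close> is 0.\<close>

lemma even_iff_wit_cof: "even n \<longleftrightarrow> wit_cof n \<noteq> 1"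
  by (auto simp: wit_cof_def multiplicity_eq_zero_iff)

lemma ev_dyadic_half:
  assumes "ev_dyadic f"
  shows "ev_dyadic (\<lambda>q. wit_half (f q))"
proof -
  obtain P where P: "dyadic_poly P" "\<forall>\<^sub>F q in sequentially. of_nat (f q) = poly P (2 ^ q)"
    using assms by (rule ev_dyadicE)
  have halved: ?thesis if ev: "\<forall>\<^sub>F q in sequentially. wit_cof (f q) \<noteq> 1"
  proof (rule ev_dyadicI)
    show "dyadic_poly (smult (2 powi (-1)) P)"
      using dyadic_powi P(1) by (rule dyadic_poly_smult)
    from P(2) ev show "\<forall>\<^sub>F q in sequentially.
      of_nat (wit_half (f q)) = poly (smult (2 powi (-1)) P) (2 ^ q)"
    proof eventually_elim
      case (elim q)
      then obtain m where "f q = 2 * m" using even_iff_wit_cof by blast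
      then show ?case by (simp add: wit_half_def power_int_minus flip: elim(1))
    qed
  qed
  from ev_dyadic_cof_obst[OF assms, THEN conjunct1] ev_dyadic_const[of 1] show ?thesis
  proof (rule ev_dyadic_compare)
    assume "\<forall>\<^sub>F q in sequentially. wit_cof (f q) = 1"
    then have "\<forall>\<^sub>F q in sequentially. wit_half (f q) = 0"
      by eventually_elim (simp add: wit_half_def even_iff_wit_cof)
    then show ?thesis by (rule ev_dyadic_cong[OF ev_dyadic_const])
  \<comment> \<open>Values of \<open>wit_cof\<close> below 1 (argument zero) and above 1 (positive
    even argument) both lead to halving.\<close>
  qed (auto intro!: halved elim: eventually_mono)
qed

section \<open>Induction on terms\<close>

lemma ev_dyadic_eval: "ev_dyadic (\<lambda>q. wit_eval (\<lambda>_. c q) t)"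
  by (induction t)
    (simp_all add: ev_dyadic_c ev_dyadic_const ev_dyadic_add ev_dyadic_mult ev_dyadic_sub
      ev_dyadic_po ev_dyadic_quo ev_dyadic_half ev_dyadic_cof_obst)

text \<open>Links an assignment updated only at \<open>x\<close> with the constant assignment used
  in the induction.\<close>

lemma wit_eval_cong: "(\<And>v. v \<in> fv t \<Longrightarrow> \<sigma> v = \<tau> v) \<Longrightarrow> wit_eval \<sigma> t = wit_eval \<tau> t"
  by (induction t) auto

theorem lemma8:
  fixes t :: "nat wit_term" and x :: nat
  assumes "fv t \<subseteq> {x}"
  shows "\<exists>(Q :: rat poly) (q\<^sub>t :: nat).
           (\<forall>i. coeff Q i \<in> dyadic) \<and>
           (\<forall>q \<ge> q\<^sub>t. q \<ge> 2 \<longrightarrow>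
              (\<forall>\<sigma> :: nat \<Rightarrow> nat.
                 of_nat (wit_eval (\<sigma>(x := c q)) t) = poly Q (of_nat (U q))))"
proof -
  \<comment> \<open>The right-hand side is free of \<open>\<sigma>\<close>, so one polynomial and
    one threshold serve all assignments.\<close>
  have eval: "wit_eval (\<sigma>(x := c q)) t = wit_eval (\<lambda>_. c q) t" for \<sigma> q
    using assms by (intro wit_eval_cong) auto
  obtain Q where Q: "dyadic_poly Q"
    "\<forall>\<^sub>F q in sequentially. of_nat (wit_eval (\<lambda>_. c q) t) = poly Q (2 ^ q)"
    using ev_dyadic_eval by (rule ev_dyadicE)
  then obtain N where "\<forall>q \<ge> N. of_nat (wit_eval (\<lambda>_. c q) t) = poly Q (2 ^ q)"
    unfolding eventually_sequentially by blast
  then show ?thesis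
    using Q(1) unfolding dyadic_poly_def eval
    by (intro exI[of _ Q] exI[of _ N]) (simp add: U_def)
qed

end
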